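(* Let $S,A$ be nonempty finite sets and let $T\subseteq S\triangleright A$ be a class of policies in which all nondeterministic policies are nontrivially decomposable (within $T$). Then only deterministic policies can be $T$-specifiable: if $\pi\in T$ and there is a teleo-environment $\varepsilon\in A\triangleright(S\times G)$ such that for every $\pi'\in T$, $\mathcal{S}(\pi',\varepsilon)\ge\mathcal{S}(\pi,\varepsilon)$ implies $\pi'=\pi$, then $\pi$ is deterministic.
   Context: For a finite set $X$, $P(X)$ is the set of probability distributions on $X$ and $\mathrm{supp}(p)$ is the support of $p\in P(X)$. For finite sets $I$ (inputs) and $O$ (outputs), the set $I \triangleright O$ of transducers is defined coinductively (it is the final coalgebra of $X \mapsto \sum_{p \in P(O)} (I \times \mathrm{supp}(p) \to X)$): a transducer $\pi$ is a pair $(\mathbb{P}_\pi, \mathbb{T}_\pi)$ with $\mathbb{P}_\pi \in P(O)$ and $\mathbb{T}_\pi : I \times \mathrm{supp}(\mathbb{P}_\pi) \to I \triangleright O$. Deterministic transducers are defined coinductively: $\pi$ is deterministic if $\mathbb{P}_\pi$ is a one-point distribution and $\mathbb{T}_\pi$ takes values in deterministic transducers; otherwise it is nondeterministic. Mixtures: for transducers $\pi_k\in I\triangleright O$ ($k\ge1$) and $\alpha_k\ge 0$ with $\sum_{k=1}^\infty\alpha_k=1$, the mixture $\sigma=\sum_{k=1}^\infty\alpha_k\pi_k$ is defined corecursively by $\mathbb{P}_\sigma=\sum_k\alpha_k\mathbb{P}_{\pi_k}$ and $\mathbb{T}_\sigma(i,o)=\sum_k \frac{\alpha_k\mathbb{P}_{\pi_k}(o)}{\sum_l\alpha_l\mathbb{P}_{\pi_l}(o)}\mathbb{T}_{\pi_k}(i,o)$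 for $o\in\mathrm{supp}(\mathbb{P}_\sigma)$ (again a mixture; terms with zero coefficient are omitted). Let $G = \{\bot,\top\}$ ($\top$ = success). A policy is an element of $S\triangleright A$; a teleo-environment is an element of $A \triangleright (S\times G)$. A policy $\pi\in T$ is nontrivially decomposable (within $T$) if there are policies $\pi_k\in T$ with $\pi_k\ne\pi$ and numbers $\alpha_k\ge0$ (weights of a mixture, not all zero) such that $\pi=\sum_{k=1}^\infty\alpha_k\pi_k$. The success probability $\mathcal{S}(\pi,\varepsilon)$ is $\lim_{n\to\infty} \mathcal{S}_n(\pi,\varepsilon)$, where $\mathcal{S}_0(\pi,\varepsilon) = \sum_{s\in S} \mathbb{P}_\varepsilon(s,\top)$ and $\mathcal{S}_{n+1}(\pi,\varepsilon) = \sum_{s\in S}\sum_{a\in A} \left[\mathbb{P}_\pi(a)\mathbb{P}_\varepsilon(s,\top) + \mathbb{P}_\pi(a)\mathbb{P}_\varepsilon(s,\bot)\, \mathcal{S}_n\big(\mathbb{T}_\pi(s,a), \mathbb{T}_\varepsilon(a,(s,\bot))\big)\right]$ (terms with zero coefficient are omitted). *)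

theory Defs
  imports "HOL-Probability.Probability"
begin

text \<open>
  Finite nonempty sets are rendered as types of class \<open>finite\<close>.  The continuation of a transducer
  is a partial map, and \<open>transducers\<close> is the set of those trees in which the domain of this map is,
  at every node, all inputs times the support of the output distribution.  On that set, equality of
  codatatype elements is equality in the final coalgebra of \<open>X \<mapsto> \<Sum>p. (I \<times> supp p \<rightarrow> X)\<close>.
\<close>

codatatype ('i, 'o) transducer =
  Transducer (out_dist: "'o pmf") (cont: "'i \<times> 'o \<rightharpoonup> ('i, 'o) transducer")

coinductive is_transducer :: "('i, 'o) transducer \<Rightarrow> bool" where
  "dom (cont \<pi>) = UNIV \<times> set_pmf (out_dist \<pi>) \<Longrightarrow>
   (\<forall>\<tau>\<in>ran (cont \<pi>). is_transducer \<tau>) \<Longrightarrow> is_transducer \<pi>"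

definition transducers :: "('i, 'o) transducer set" where
  "transducers = {\<pi>. is_transducer \<pi>}"

coinductive deterministic :: "('i, 'o) transducer \<Rightarrow> bool" where
  "(\<exists>x. out_dist \<pi> = return_pmf x) \<Longrightarrow>
   (\<forall>\<tau>\<in>ran (cont \<pi>). deterministic \<tau>) \<Longrightarrow> deterministic \<pi>"

text \<open>
  The mixture of the family \<open>p\<close> with weights \<open>\<alpha>\<close>, indexed from 0; it is meaningful for
  \<open>mixture_weights \<alpha>\<close> and \<open>range p \<subseteq> transducers\<close>.  Where \<open>cont (p k) (i, x)\<close> is undefined, the
  new weight of the index \<open>k\<close> is 0, so the arbitrary value of \<open>the\<close> does not enter the mixture.
\<close>

definition mixture_weights :: "(nat \<Rightarrow> real) \<Rightarrow> bool" where
  "mixture_weights \<alpha> \<longleftrightarrow> (\<forall>k. 0 \<le> \<alpha> k) \<and> \<alpha> sums 1"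

definition mix_dist :: "(nat \<Rightarrow> real) \<Rightarrow> (nat \<Rightarrow> 'o pmf) \<Rightarrow> 'o pmf" where
  "mix_dist \<alpha> q = embed_pmf (\<lambda>x. \<Sum>k. \<alpha> k * pmf (q k) x)"

primcorec mixture :: "(nat \<Rightarrow> real) \<Rightarrow> (nat \<Rightarrow> ('i, 'o) transducer) \<Rightarrow> ('i, 'o) transducer" where
  "out_dist (mixture \<alpha> p) = mix_dist \<alpha> (\<lambda>k. out_dist (p k))"
| "cont (mixture \<alpha> p) = (\<lambda>(i, x).
     if x \<in> set_pmf (mix_dist \<alpha> (\<lambda>k. out_dist (p k)))
     then Some (mixture
       (\<lambda>k. \<alpha> k * pmf (out_dist (p k)) x / (\<Sum>l. \<alpha> l * pmf (out_dist (p l)) x))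
       (\<lambda>k. the (cont (p k) (i, x))))
     else None)"

definition nontrivially_decomposable ::
  "('i, 'o) transducer set \<Rightarrow> ('i, 'o) transducer \<Rightarrow> bool" where
  "nontrivially_decomposable T \<pi> \<longleftrightarrow>
     (\<exists>p \<alpha>. (\<forall>k. p k \<in> T \<and> p k \<noteq> \<pi>) \<and> mixture_weights \<alpha> \<and> \<pi> = mixture \<alpha> p)"

type_synonym ('s, 'a) policy = "('s, 'a) transducer"

text \<open>The goal component is \<open>bool\<close>, with \<open>True\<close> for success.\<close>

type_synonym ('s, 'a) teleo_environment = "('a, 's \<times> bool) transducer"

text \<open>As above, undefined continuations occur only with coefficient 0.\<close>

primrec success_upto ::
  "nat \<Rightarrow> ('s::finite, 'a::finite) policy \<Rightarrow> ('s, 'a) teleo_environment \<Rightarrow> real" where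
  "success_upto 0 \<pi> \<epsilon> = (\<Sum>s\<in>UNIV. pmf (out_dist \<epsilon>) (s, True))"
| "success_upto (Suc n) \<pi> \<epsilon> = (\<Sum>s\<in>UNIV. \<Sum>a\<in>UNIV.
     pmf (out_dist \<pi>) a * pmf (out_dist \<epsilon>) (s, True)
     + pmf (out_dist \<pi>) a * pmf (out_dist \<epsilon>) (s, False)
       * success_upto n (the (cont \<pi> (s, a))) (the (cont \<epsilon> (a, (s, False)))))"

definition success_probability ::
  "('s::finite, 'a::finite) policy \<Rightarrow> ('s, 'a) teleo_environment \<Rightarrow> real" where
  "success_probability \<pi> \<epsilon> = lim (\<lambda>n. success_upto n \<pi> \<epsilon>)"

definition specifiable ::
  "('s::finite, 'a::finite) policy set \<Rightarrow> ('s, 'a) policy \<Rightarrow> bool" where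
  "specifiable T \<pi> \<longleftrightarrow> \<pi> \<in> T \<and>
     (\<exists>\<epsilon>\<in>transducers. \<forall>\<pi>'\<in>T.
        success_probability \<pi>' \<epsilon> \<ge> success_probability \<pi> \<epsilon> \<longrightarrow> \<pi>' = \<pi>)"

text \<open>Well-definedness of the limit and of mixtures.\<close>

lemma success_upto_Suc:
  "success_upto (Suc n) \<pi> \<epsilon> = (\<Sum>s\<in>UNIV. pmf (out_dist \<epsilon>) (s, True)) +
     (\<Sum>s\<in>UNIV. \<Sum>a\<in>UNIV. pmf (out_dist \<pi>) a * pmf (out_dist \<epsilon>) (s, False)
       * success_upto n (the (cont \<pi> (s, a))) (the (cont \<epsilon> (a, (s, False)))))"
proof -
  have "(\<Sum>a\<in>UNIV. pmf (out_dist \<pi>) a * c) = c" for c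
    using sum_pmf_eq_1[of "UNIV" "out_dist \<pi>"] by (simp flip: sum_distrib_right)
  then show ?thesis by (simp add: sum.distrib)
qed

lemma success_upto_bounds: "0 \<le> success_upto n \<pi> \<epsilon> \<and> success_upto n \<pi> \<epsilon> \<le> 1"
proof (induction n arbitrary: \<pi> \<epsilon>)
  case 0
  have "(\<Sum>s\<in>UNIV. pmf (out_dist \<epsilon>) (s, True)) = (\<Sum>x\<in>UNIV \<times> {True}. pmf (out_dist \<epsilon>) x)"
    by (rule sum.reindex_bij_witness[of _ fst "\<lambda>s. (s, True)"]) auto
  also have "\<dots> \<le> (\<Sum>x\<in>UNIV. pmf (out_dist \<epsilon>) x)"
    by (rule sum_mono2) auto
  also have "\<dots> = 1"
    by (rule sum_pmf_eq_1) auto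
  finally show ?case by (simp add: sum_nonneg)
next
  case (Suc n)
  let ?q = "out_dist \<epsilon>"
  have one: "(\<Sum>s\<in>UNIV. pmf ?q (s, True)) + (\<Sum>s\<in>UNIV. pmf ?q (s, False)) = 1"
  proof -
    have "(\<Sum>(s, g)\<in>UNIV \<times> UNIV. pmf ?q (s, g)) = 1"
      using sum_pmf_eq_1[of UNIV ?q] by simp
    then show ?thesis
      unfolding sum.cartesian_product[symmetric] by (simp add: UNIV_bool sum.distrib add.commute)
  qed
  let ?R = "\<Sum>s\<in>UNIV. \<Sum>a\<in>UNIV. pmf (out_dist \<pi>) a * pmf ?q (s, False)
       * success_upto n (the (cont \<pi> (s, a))) (the (cont \<epsilon> (a, (s, False))))"
  have "?R \<le> (\<Sum>s\<in>UNIV. \<Sum>a\<in>UNIV. pmf (out_dist \<pi>) a * pmf ?q (s, False))"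
    by (intro sum_mono mult_right_le_one_le) (use Suc in auto)
  also have "\<dots> = (\<Sum>s\<in>UNIV. pmf ?q (s, False))"
    using sum_pmf_eq_1[of "UNIV" "out_dist \<pi>"] by (simp flip: sum_distrib_right)
  finally have "?R \<le> (\<Sum>s\<in>UNIV. pmf ?q (s, False))" .
  moreover have "0 \<le> ?R"
    by (intro sum_nonneg mult_nonneg_nonneg) (use Suc in auto)
  moreover have "0 \<le> (\<Sum>s\<in>UNIV. pmf ?q (s, True))"
    by (intro sum_nonneg) auto
  ultimately show ?case
    using one unfolding success_upto_Suc by linarith
qed

lemma success_upto_mono: "success_upto n \<pi> \<epsilon> \<le> success_upto (Suc n) \<pi> \<epsilon>"
proof (induction n arbitrary: \<pi> \<epsilon>)
  case 0
  show ?case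
    unfolding success_upto_Suc using success_upto_bounds[of 0]
    by (auto intro!: sum_nonneg mult_nonneg_nonneg)
next
  case (Suc n)
  show ?case
    unfolding success_upto_Suc[of "Suc n" \<pi> \<epsilon>] success_upto_Suc[of n \<pi> \<epsilon>]
    by (intro add_left_mono sum_mono mult_left_mono Suc) auto
qed

lemma success_upto_tendsto: "(\<lambda>n. success_upto n \<pi> \<epsilon>) \<longlonglongrightarrow> success_probability \<pi> \<epsilon>"
proof -
  have "incseq (\<lambda>n. success_upto n \<pi> \<epsilon>)"
    by (intro incseq_SucI success_upto_mono)
  then have "convergent (\<lambda>n. success_upto n \<pi> \<epsilon>)"
    using success_upto_bounds by (metis incseq_convergent convergent_def)
  then show ?thesis
    unfolding success_probability_def by (simp add: convergent_LIMSEQ_iff)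
qed

lemma mixture_summable:
  assumes "mixture_weights \<alpha>"
  shows "summable (\<lambda>k. \<alpha> k * pmf (q k) x)"
proof (rule summable_comparison_test')
  show "summable \<alpha>"
    using assms by (auto simp: mixture_weights_def sums_iff)
  show "norm (\<alpha> k * pmf (q k) x) \<le> \<alpha> k" if "k \<ge> 0" for k
    using assms pmf_le_1[of "q k" x] by (auto simp: mixture_weights_def mult_left_le)
qed

lemma pmf_mix_dist:
  assumes "mixture_weights \<alpha>"
  shows "pmf (mix_dist \<alpha> q) x = (\<Sum>k. \<alpha> k * pmf (q k) x)"
  unfolding mix_dist_def
proof (rule pmf_embed_pmf)
  have nonneg: "0 \<le> \<alpha> k" for k
    using assms by (simp add: mixture_weights_def)
  show "0 \<le> (\<Sum>k. \<alpha> k * pmf (q k) y)" for y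
    by (intro suminf_nonneg mixture_summable assms mult_nonneg_nonneg nonneg) auto
  have "ennreal (\<Sum>k. \<alpha> k * pmf (q k) y) = (\<Sum>k. ennreal (\<alpha> k) * ennreal (pmf (q k) y))" for y
    using nonneg mixture_summable[OF assms, of q y]
    by (subst suminf_ennreal2[symmetric]) (auto simp: ennreal_mult)
  then have "(\<integral>\<^sup>+y. ennreal (\<Sum>k. \<alpha> k * pmf (q k) y) \<partial>count_space UNIV)
      = (\<Sum>k. \<integral>\<^sup>+y. ennreal (\<alpha> k) * ennreal (pmf (q k) y) \<partial>count_space UNIV)"
    by (simp add: nn_integral_suminf)
  also have "\<dots> = (\<Sum>k. ennreal (\<alpha> k))"
    by (simp add: nn_integral_cmult nn_integral_pmf)
  also have "\<dots> = 1"
    using assms nonneg by (subst suminf_ennreal2) (auto simp: mixture_weights_def sums_iff)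
  finally show "(\<integral>\<^sup>+y. ennreal (\<Sum>k. \<alpha> k * pmf (q k) y) \<partial>count_space UNIV) = 1" .
qed

lemma mixture_weights_cont:
  assumes "mixture_weights \<alpha>" and "x \<in> set_pmf (mix_dist \<alpha> q)"
  shows "mixture_weights (\<lambda>k. \<alpha> k * pmf (q k) x / (\<Sum>l. \<alpha> l * pmf (q l) x))"
proof -
  let ?c = "\<Sum>l. \<alpha> l * pmf (q l) x"
  have c: "?c > 0"
    using assms(2) pmf_mix_dist[OF assms(1), of q x] by (metis pmf_positive)
  have "(\<lambda>k. \<alpha> k * pmf (q k) x / ?c) sums (?c / ?c)"
    by (intro sums_divide summable_sums mixture_summable assms)
  then show ?thesis
    using c assms(1) by (auto simp: mixture_weights_def)
qed

lemma mixture_in_transducers: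
  assumes "mixture_weights \<alpha>"
  shows "mixture \<alpha> p \<in> transducers"
proof -
  have "is_transducer \<sigma>" if "\<exists>\<alpha> p. mixture_weights \<alpha> \<and> \<sigma> = mixture \<alpha> p" for \<sigma> :: "('a, 'b) transducer"
    using that
  proof (coinduction arbitrary: \<sigma> rule: is_transducer.coinduct)
    case is_transducer
    then obtain \<alpha> and p :: "nat \<Rightarrow> ('a, 'b) transducer"
      where \<alpha>: "mixture_weights \<alpha>" and \<sigma>: "\<sigma> = mixture \<alpha> p" by blast
    have "dom (cont \<sigma>) = UNIV \<times> set_pmf (out_dist \<sigma>)"
      unfolding \<sigma> by (auto simp: dom_def split: if_splits)
    moreover have "\<exists>\<alpha> p. mixture_weights \<alpha> \<and> \<tau> = mixture \<alpha> p" if "\<tau> \<in> ran (cont \<sigma>)" for \<tau>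
      using that mixture_weights_cont[OF \<alpha>, of _ "\<lambda>k. out_dist (p k)"] unfolding \<sigma>
      by (auto simp: ran_def split: if_splits)
    ultimately show ?case by blast
  qed
  then show ?thesis
    using assms by (auto simp: transducers_def)
qed

end

theory Submission imports Defs begin

text \<open>
  For a fixed teleo-environment the success probability is affine in the policy, also along countable
  mixtures.  If every policy of \<open>T\<close> other than \<open>\<pi>\<close> did strictly worse than \<open>\<pi>\<close>, a mixture of such
  policies would do strictly worse as well, so \<open>\<pi>\<close> cannot be decomposed.
\<close>

lemma mixture_weights_sums:
  assumes "mixture_weights \<alpha>"
  shows "(\<lambda>k. \<alpha> k * pmf (q k) x) sums pmf (mix_dist \<alpha> q) x"
  unfolding pmf_mix_dist[OF assms] by (intro summable_sums mixture_summable assms)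

text \<open>Induction on \<open>n\<close> with \<alpha>, \<open>p\<close> and \<epsilon> arbitrary,
  since continuing a mixture gives a mixture with posterior weights. Their denominator is the
  probability of the action \<open>a\<close> under the mixture, exactly the factor that
  \<open>success_upto\<close> puts before the continuation, so the two cancel and linearity
  survives.\<close>

lemma success_upto_mixture:
  assumes "mixture_weights \<alpha>"
  shows "(\<lambda>k. \<alpha> k * success_upto n (p k) \<epsilon>) sums success_upto n (mixture \<alpha> p) \<epsilon>"
  using assms
proof (induction n arbitrary: \<alpha> p \<epsilon>)
  case 0
  then show ?case
    using sums_mult2[of \<alpha> 1] by (auto simp: mixture_weights_def)
next
  case (Suc n)
  define q where "q = (\<lambda>k. out_dist (p k))"
  define f where "f = (\<lambda>s a k. success_upto n (the (cont (p k) (s, a))) (the (cont \<epsilon> (a, (s, False)))))"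
  have step: "(\<lambda>k. \<alpha> k * (pmf (q k) a * pmf (out_dist \<epsilon>) (s, False) * f s a k)) sums
      (pmf (out_dist (mixture \<alpha> p)) a * pmf (out_dist \<epsilon>) (s, False) *
       success_upto n (the (cont (mixture \<alpha> p) (s, a))) (the (cont \<epsilon> (a, (s, False)))))" for s a
  proof (cases "a \<in> set_pmf (mix_dist \<alpha> q)")
    case True
    let ?c = "pmf (mix_dist \<alpha> q) a"
    have "?c > 0"
      using True by (rule pmf_positive)
    have cont: "the (cont (mixture \<alpha> p) (s, a))
        = mixture (\<lambda>k. \<alpha> k * pmf (q k) a / ?c) (\<lambda>k. the (cont (p k) (s, a)))"
      using True by (simp add: pmf_mix_dist[OF Suc.prems] q_def)
    have "mixture_weights (\<lambda>k. \<alpha> k * pmf (q k) a / ?c)"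
      using mixture_weights_cont[OF Suc.prems True] by (simp add: pmf_mix_dist[OF Suc.prems])
    \<comment> \<open>The factor \<open>?c\<close> in the scalar clears the denominator of the
      posterior weights.\<close>
    from sums_mult[OF Suc.IH[OF this, of "\<lambda>k. the (cont (p k) (s, a))" "the (cont \<epsilon> (a, (s, False)))"],
        of "?c * pmf (out_dist \<epsilon>) (s, False)"]
    show ?thesis
      unfolding cont f_def using \<open>?c > 0\<close> by (simp add: q_def field_simps)
  next
    case False
    then have "pmf (mix_dist \<alpha> q) a = 0"
      by (simp add: set_pmf_iff)
    \<comment> \<open>A series of nonnegative terms with sum 0 vanishes termwise. Hence both sides
      multiply the continuation values by 0, including the arbitrary value of \<open>the\<close>
      where the mixture has no continuation.\<close>
    moreover from this have "\<alpha> k * pmf (q k) a = 0" for k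
      using suminf_eq_zero_iff[OF mixture_summable[OF Suc.prems, of q a]] Suc.prems
      by (simp add: pmf_mix_dist[OF Suc.prems] mixture_weights_def)
    then have "(\<lambda>k. \<alpha> k * (pmf (q k) a * pmf (out_dist \<epsilon>) (s, False) * f s a k)) = (\<lambda>k. 0)"
      by (metis mult.assoc mult_zero_left)
    ultimately show ?thesis
      by (simp only: mixture.sel q_def mult_zero_left sums_zero)
  qed
  \<comment> \<open>Immediate success does not depend on the policy, so it is merely multiplied by
    the total weight 1.\<close>
  have "(\<lambda>k. \<alpha> k * (\<Sum>s\<in>UNIV. pmf (out_dist \<epsilon>) (s, True)))
      sums (\<Sum>s\<in>UNIV. pmf (out_dist \<epsilon>) (s, True))"
    using Suc.prems sums_mult2[of \<alpha> 1] by (auto simp: mixture_weights_def)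
  from sums_add[OF this sums_sum[OF sums_sum[OF step]]]
  show ?case
    unfolding success_upto_Suc q_def f_def by (simp only: sum_distrib_left distrib_left)
qed

lemma success_upto_le_probability: "success_upto n \<pi> \<epsilon> \<le> success_probability \<pi> \<epsilon>"
  by (rule incseq_le[OF incseq_SucI success_upto_tendsto]) (rule success_upto_mono)

lemma success_probability_bounds: "0 \<le> success_probability \<pi> \<epsilon>" "success_probability \<pi> \<epsilon> \<le> 1"
  by (intro LIMSEQ_le_const[OF success_upto_tendsto] LIMSEQ_le_const2[OF success_upto_tendsto] exI allI impI;
      simp add: success_upto_bounds)+

text \<open>An upper bound suffices, so limit and series are never exchanged: each truncated value
  of the mixture is at most the weighted sum of the limits \<open>?S k\<close>, and this bound
  passes to the limit in \<open>n\<close>.\<close>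

lemma success_probability_mixture_less:
  assumes \<alpha>: "mixture_weights \<alpha>" and less: "\<And>k. success_probability (p k) \<epsilon> < c"
  shows "success_probability (mixture \<alpha> p) \<epsilon> < c"
proof -
  let ?S = "\<lambda>k. success_probability (p k) \<epsilon>"
  have nonneg: "\<And>k. 0 \<le> \<alpha> k" and sums: "\<alpha> sums 1"
    using \<alpha> by (auto simp: mixture_weights_def)
  have summable: "summable (\<lambda>k. \<alpha> k * ?S k)"
  proof (rule summable_comparison_test')
    show "summable \<alpha>"
      using sums by (rule sums_summable)
    show "norm (\<alpha> k * ?S k) \<le> \<alpha> k" if "k \<ge> 0" for k
      using nonneg[of k] success_probability_bounds[of "p k" \<epsilon>] by (simp add: mult_left_le)
  qed
  have upto_le: "success_upto n (mixture \<alpha> p) \<epsilon> \<le> (\<Sum>k. \<alpha> k * ?S k)" for n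
    by (intro sums_le[OF _ success_upto_mixture[OF \<alpha>] summable_sums[OF summable]]
        mult_left_mono success_upto_le_probability nonneg)
  have "success_probability (mixture \<alpha> p) \<epsilon> \<le> (\<Sum>k. \<alpha> k * ?S k)"
    using upto_le by (intro LIMSEQ_le_const2[OF success_upto_tendsto]) blast
  also have "\<dots> < c"
  proof -
    \<comment> \<open>With infinitely many policies the gaps \<open>c - ?S k\<close> may tend to 0,
      but a single index of positive weight already makes the weighted gap strictly
      positive.\<close>
    have "\<exists>k. \<alpha> k \<noteq> 0"
    proof (rule ccontr)
      assume "\<nexists>k. \<alpha> k \<noteq> 0"
      then have "\<alpha> sums 0"
        by (simp add: sums_0)
      then show False
        using sums_unique2[OF sums, of 0] by simp
    qed
    then obtain k where "\<alpha> k > 0"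
      using nonneg by (auto simp: less_le)
    have "(\<lambda>k. \<alpha> k * c - \<alpha> k * ?S k) sums (1 * c - (\<Sum>k. \<alpha> k * ?S k))"
      by (intro sums_diff sums_mult2 sums summable_sums summable)
    then have diff: "(\<lambda>k. \<alpha> k * (c - ?S k)) sums (c - (\<Sum>k. \<alpha> k * ?S k))"
      by (simp add: right_diff_distrib)
    have "0 < (\<Sum>k. \<alpha> k * (c - ?S k))"
      using \<open>\<alpha> k > 0\<close> less nonneg
      by (intro suminf_pos2[where i = k] sums_summable[OF diff]) (auto simp: less_imp_le)
    then show ?thesis
      using sums_unique[OF diff] by simp
  qed
  finally show ?thesis .
qed

theorem theorem6p2p3:
  fixes T :: "('s::finite, 'a::finite) policy set"
    and \<pi> :: "('s, 'a) policy"
  assumes "T \<subseteq> transducers"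
    and "\<forall>\<rho>\<in>T. \<not> deterministic \<rho> \<longrightarrow> nontrivially_decomposable T \<rho>"
    and "specifiable T \<pi>"
  shows "deterministic \<pi>"
proof (rule ccontr)
  assume "\<not> deterministic \<pi>"
  with assms obtain p \<alpha> where p: "\<And>k. p k \<in> T" "\<And>k. p k \<noteq> \<pi>"
    and \<alpha>: "mixture_weights \<alpha>" and \<pi>: "\<pi> = mixture \<alpha> p"
    unfolding specifiable_def nontrivially_decomposable_def by metis
  from assms(3) obtain \<epsilon> where
    "\<And>\<pi>'. \<pi>' \<in> T \<Longrightarrow> success_probability \<pi>' \<epsilon> \<ge> success_probability \<pi> \<epsilon> \<Longrightarrow> \<pi>' = \<pi>"
    unfolding specifiable_def by blast
  \<comment> \<open>Contrapositive of specifiability, applied to the components \<open>p k\<close>,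
    which differ from \<pi>.\<close>
  then have "success_probability (p k) \<epsilon> < success_probability \<pi> \<epsilon>" for k
    using p[of k] by (meson not_less)
  then show False
    using success_probability_mixture_less[OF \<alpha>, of p \<epsilon> "success_probability \<pi> \<epsilon>"] \<pi> by simp
qed

end
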